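(* Let $(\Xi,d)$ be a Polish space, $p\in[1,\infty)$, $\nu\in\mathcal P(\Xi)$, $\theta>0$, and let $\Psi:\Xi\to\mathbb R$ be Borel measurable with $\int_\Xi|\Psi|\,d\nu<\infty$. Suppose that the growth rate satisfies $\kappa=\infty$. Then $v_P=v_D=\infty$, where $$v_P=\sup_{\mu\in\mathcal P(\Xi)}\Big\{\int_\Xi\Psi(\xi)\,\mu(d\xi)\;:\;W_p(\mu,\nu)\le\theta\Big\},\qquad v_D=\inf_{\lambda\ge0}\Big\{\lambda\theta^p-\int_\Xi\inf_{\xi\in\Xi}\big[\lambda d^p(\xi,\zeta)-\Psi(\xi)\big]\,\nu(d\zeta)\Big\}.$$
   Context: $\mathcal P(\Xi)$ is the set of Borel probability measures on $\Xi$, and $d^p(\xi,\zeta):=d(\xi,\zeta)^p$. For $\mu,\nu\in\mathcal P(\Xi)$, $W_p(\mu,\nu)\in[0,\infty]$ is defined by $W_p^p(\mu,\nu)=\min_\gamma\int_{\Xi\times\Xi}d^p(\xi,\zeta)\,\gamma(d\xi,d\zeta)$, over $\gamma\in\mathcal P(\Xi\times\Xi)$ with first marginal $\mu$ and second marginal $\nu$. Let $\Phi(\lambda,\zeta):=\inf_{\xi\in\Xi}\{\lambda d^p(\xi,\zeta)-\Psi(\xi)\}\in[-\infty,\infty)$ for $\lambda\ge 0$. $\Phi(\lambda,\cdot)$ is measurable with respect to the $\nu$-completion of the Borel $\sigma$-algebra, and $\Phi(\lambda,\zeta)\le-\Psi(\zeta)$, so $\int\Phi(\lambda,\zeta)\,\nu(d\zeta)\in[-\infty,\infty)$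 is well defined. The growth rate of $\Psi$ is $\kappa:=\inf\{\lambda\ge0:\int_\Xi\Phi(\lambda,\zeta)\,\nu(d\zeta)>-\infty\}$, with $\kappa=\infty$ if no such $\lambda$ exists. The supremum in $v_P$ is over $\mu$ for which $\int\Psi\,d\mu$ is well defined in $[-\infty,\infty]$. *)

theory Defs
  imports "HOL-Probability.Probability"
begin

abbreviation borel_probs :: "'a::topological_space measure set" where
  "borel_probs \<equiv> space (prob_algebra borel)"

lemma borel_probs_iff: "\<mu> \<in> borel_probs \<longleftrightarrow> sets \<mu> = sets borel \<and> prob_space \<mu>"
  by (auto simp: space_prob_algebra)

definition couplings ::
  "'a::topological_space measure \<Rightarrow> 'a measure \<Rightarrow> ('a \<times> 'a) measure set" where
  "couplings \<mu> \<nu> = {\<gamma> \<in> borel_probs. distr \<gamma> borel fst = \<mu> \<and> distr \<gamma> borel snd = \<nu>}"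

definition transport_cost ::
  "real \<Rightarrow> 'a::polish_space measure \<Rightarrow> 'a measure \<Rightarrow> ennreal" where
  "transport_cost p \<mu> \<nu> =
     (INF \<gamma>\<in>couplings \<mu> \<nu>. \<integral>\<^sup>+ (\<xi>, \<zeta>). ennreal (dist \<xi> \<zeta> powr p) \<partial>\<gamma>)"

text \<open>The distance is the \<open>p\<close>-th root of the transport cost, taken in the extended
  nonnegative reals. The case \<open>\<top>\<close> is separate because \<open>enn2real \<top> = 0\<close>.\<close>

definition wasserstein ::
  "real \<Rightarrow> 'a::polish_space measure \<Rightarrow> 'a measure \<Rightarrow> ennreal" where
  "wasserstein p \<mu> \<nu> =
     (if transport_cost p \<mu> \<nu> = \<top> then \<top>
      else ennreal (enn2real (transport_cost p \<mu> \<nu>) powr (1 / p)))"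

text \<open>Integrals with values in \<open>[-\<infinity>, \<infinity>]\<close>: since \<open>e2ennreal\<close> truncates negative
  values to \<open>0\<close>, the two integrals below are those of the positive and the negative part.
  The value \<open>ext_integral M f\<close> is meaningful only if \<open>has_ext_integral M f\<close>.\<close>

definition has_ext_integral :: "'a measure \<Rightarrow> ('a \<Rightarrow> ereal) \<Rightarrow> bool" where
  "has_ext_integral M f \<longleftrightarrow> f \<in> borel_measurable M \<and>
     ((\<integral>\<^sup>+ x. e2ennreal (f x) \<partial>M) < \<top> \<or> (\<integral>\<^sup>+ x. e2ennreal (- f x) \<partial>M) < \<top>)"

definition ext_integral :: "'a measure \<Rightarrow> ('a \<Rightarrow> ereal) \<Rightarrow> ereal" where
  "ext_integral M f =
     enn2ereal (\<integral>\<^sup>+ x. e2ennreal (f x) \<partial>M) - enn2ereal (\<integral>\<^sup>+ x. e2ennreal (- f x) \<partial>M)"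

definition Phi :: "real \<Rightarrow> ('a::polish_space \<Rightarrow> real) \<Rightarrow> real \<Rightarrow> 'a \<Rightarrow> ereal" where
  "Phi p \<Psi> l \<zeta> = (INF \<xi>. ereal (l * dist \<xi> \<zeta> powr p - \<Psi> \<xi>))"

definition growth_rate :: "real \<Rightarrow> 'a::polish_space measure \<Rightarrow> ('a \<Rightarrow> real) \<Rightarrow> ereal" where
  "growth_rate p \<nu> \<Psi> =
     Inf {ereal l | l. 0 \<le> l \<and> ext_integral \<nu> (Phi p \<Psi> l) > - \<infinity>}"

definition primal_value ::
  "real \<Rightarrow> real \<Rightarrow> 'a::polish_space measure \<Rightarrow> ('a \<Rightarrow> real) \<Rightarrow> ereal" where
  "primal_value p \<theta> \<nu> \<Psi> =
     (SUP \<mu>\<in>{\<mu> \<in> borel_probs. wasserstein p \<mu> \<nu> \<le> ennreal \<theta> \<and>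
                has_ext_integral \<mu> (\<lambda>\<xi>. ereal (\<Psi> \<xi>))}.
        ext_integral \<mu> (\<lambda>\<xi>. ereal (\<Psi> \<xi>)))"

definition dual_value ::
  "real \<Rightarrow> real \<Rightarrow> 'a::polish_space measure \<Rightarrow> ('a \<Rightarrow> real) \<Rightarrow> ereal" where
  "dual_value p \<theta> \<nu> \<Psi> =
     (INF l\<in>{0..}. ereal (l * \<theta> powr p) - ext_integral \<nu> (Phi p \<Psi> l))"

text \<open>As an infimum of continuous functions of \<open>\<zeta>\<close>, \<open>Phi p \<Psi> l\<close> is upper
  semicontinuous, so it is Borel measurable and integrating it against \<open>\<nu>\<close> is the same as
  integrating it against the completion of \<open>\<nu>\<close>.\<close>

lemma borel_measurable_Phi:
  fixes \<Psi> :: "'a::polish_space \<Rightarrow> real"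
  assumes "p \<ge> 1"
  shows "Phi p \<Psi> l \<in> borel_measurable borel"
proof (rule borel_measurableI_less)
  fix y :: ereal
  have "continuous_on UNIV (\<lambda>\<zeta>. l * dist \<xi> \<zeta> powr p - \<Psi> \<xi>)" for \<xi>
    using assms by (intro continuous_intros continuous_on_powr') auto
  then have "open {\<zeta>. ereal (l * dist \<xi> \<zeta> powr p - \<Psi> \<xi>) < y}" for \<xi>
    by (intro open_Collect_less continuous_on_ereal continuous_on_const)
  moreover have "{\<zeta>. Phi p \<Psi> l \<zeta> < y}
      = (\<Union>\<xi>. {\<zeta>. ereal (l * dist \<xi> \<zeta> powr p - \<Psi> \<xi>) < y})"
    by (auto simp: Phi_def INF_less_iff)
  ultimately have "open {\<zeta>. Phi p \<Psi> l \<zeta> < y}"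
    by auto
  then show "{\<zeta> \<in> space borel. Phi p \<Psi> l \<zeta> < y} \<in> sets borel"
    by auto
qed

lemma Phi_le: "Phi p \<Psi> l \<zeta> \<le> ereal (- \<Psi> \<zeta>)"
  unfolding Phi_def by (rule INF_lower2[of \<zeta>]) auto

lemma has_ext_integral_Phi:
  assumes "p \<ge> 1" "\<nu> \<in> borel_probs" "integrable \<nu> \<Psi>"
  shows "has_ext_integral \<nu> (Phi p \<Psi> l)"
proof -
  have meas: "Phi p \<Psi> l \<in> borel_measurable \<nu>"
    using borel_measurable_Phi[OF assms(1)] assms(2)
    by (simp add: borel_probs_iff cong: measurable_cong_sets)
  have "e2ennreal (Phi p \<Psi> l x) \<le> ennreal (norm (\<Psi> x))" for x
  proof -
    have "Phi p \<Psi> l x \<le> ereal (norm (\<Psi> x))"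
      by (rule order_trans[OF Phi_le]) auto
    then have "e2ennreal (Phi p \<Psi> l x) \<le> e2ennreal (ereal (norm (\<Psi> x)))"
      by (rule e2ennreal_mono)
    then show ?thesis
      by simp
  qed
  then have "(\<integral>\<^sup>+ x. e2ennreal (Phi p \<Psi> l x) \<partial>\<nu>) \<le> (\<integral>\<^sup>+ x. ennreal (norm (\<Psi> x)) \<partial>\<nu>)"
    by (intro nn_integral_mono) auto
  also have "\<dots> < \<top>"
    using assms(3) by (simp add: integrable_iff_bounded)
  finally show ?thesis
    using meas by (simp add: has_ext_integral_def)
qed

end

theory Submission
  imports Defs
begin

text \<open>
  The dual value is immediate: infinite growth rate says that \<open>Phi p \<Psi> l\<close> has integral
  \<open>- \<infinity>\<close> for every \<open>l \<ge> 0\<close>, so every term of the infimum is \<open>\<infinity>\<close>.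

  For the primal value, fix a price \<open>l > 0\<close> and read \<open>- Phi p \<Psi> l \<zeta>\<close> as the best net reward
  \<open>\<Psi> \<xi> - l * dist \<xi> \<zeta> powr p\<close> that a unit of mass at \<open>\<zeta>\<close> can earn by moving to some \<open>\<xi>\<close>.
  Because its integral is infinite, some measurable map \<open>T\<close> has a finite cost
  \<open>A = \<integral> dist (T \<zeta>) \<zeta> powr p\<close> and a gain \<open>B = \<integral> \<Psi> (T \<zeta>) - \<Psi> \<zeta>\<close> with \<open>B \<ge> M + l * A\<close>, for any
  prescribed \<open>M\<close> (\<open>ex_transport_map_with_large_net_gain\<close>). To choose \<open>T\<close>
  measurably, note that for a fixed target \<open>\<xi>\<close> the net reward is continuous in \<open>\<zeta>\<close>, however
  irregular \<open>\<Psi>\<close> is; so by Lindelof's theorem countably many targets suffice to approach the best net reward at all \<open>\<zeta>\<close> simultaneously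
  (\<open>countable_subfamily_same_pointwise_SUP\<close>). Let \<open>T\<close> move each point to the best of the first
  \<open>n\<close> targets, or leave it where it is if that is better. As \<open>n\<close> grows, monotone convergence makes
  the net gain arbitrarily large, and because only finitely many targets are used and each move is
  profitable, \<open>A\<close> and \<open>B\<close> are finite.

  The map \<open>T\<close> may be too expensive, so it is applied only to a fraction \<open>\<epsilon>\<close> of the mass at every
  point (\<open>mixed_transport_le_primal_value\<close>). This costs \<open>\<epsilon> * A\<close> and gains \<open>\<epsilon> * B\<close>. With
  \<open>\<epsilon> = 1\<close> if \<open>A \<le> \<theta> powr p\<close> and \<open>\<epsilon> = \<theta> powr p / A\<close> otherwise, the result is feasible and its gain is
  at least \<open>min M (l * \<theta> powr p)\<close>. Both \<open>M\<close> and \<open>l\<close> are arbitrary, so the primal value is infinite.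
\<close>

section \<open>Extended integrals\<close>

lemma ext_integral_eq_integral:
  fixes f :: "'a \<Rightarrow> real"
  assumes "integrable M f"
  shows "has_ext_integral M (\<lambda>x. ereal (f x))"
    and "ext_integral M (\<lambda>x. ereal (f x)) = ereal (integral\<^sup>L M f)"
proof -
  have m: "f \<in> borel_measurable M"
    using assms by simp
  have pos: "(\<integral>\<^sup>+ x. ennreal (f x) \<partial>M) < \<top>" and neg: "(\<integral>\<^sup>+ x. ennreal (- f x) \<partial>M) < \<top>"
    using assms by (auto simp: real_integrable_def less_top)
  show "has_ext_integral M (\<lambda>x. ereal (f x))"
    using m pos by (simp add: has_ext_integral_def)
  have "enn2ereal a = ereal (enn2real a)" if "a < \<top>" for a
    using that by (cases a) auto
  then show "ext_integral M (\<lambda>x. ereal (f x)) = ereal (integral\<^sup>L M f)"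
    using pos neg by (simp add: ext_integral_def real_lebesgue_integral_def[OF assms])
qed

lemma ext_integral_eq_MInfty_iff:
  "ext_integral M f = - \<infinity> \<longleftrightarrow>
     (\<integral>\<^sup>+ x. e2ennreal (f x) \<partial>M) < \<top> \<and> (\<integral>\<^sup>+ x. e2ennreal (- f x) \<partial>M) = \<top>"
  unfolding ext_integral_def
  by (cases "\<integral>\<^sup>+ x. e2ennreal (f x) \<partial>M"; cases "\<integral>\<^sup>+ x. e2ennreal (- f x) \<partial>M") auto

lemma ext_integral_Phi_of_infinite_growth_rate:
  assumes "growth_rate p \<nu> \<Psi> = \<infinity>" and "0 \<le> l"
  shows "ext_integral \<nu> (Phi p \<Psi> l) = - \<infinity>"
proof (rule ccontr)
  assume "ext_integral \<nu> (Phi p \<Psi> l) \<noteq> - \<infinity>"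
  then have "growth_rate p \<nu> \<Psi> \<le> ereal l"
    unfolding growth_rate_def using assms(2) by (intro Inf_lower) (auto simp: less_le)
  then show False
    using assms(1) by simp
qed

section \<open>Transport by mixtures of maps\<close>

text \<open>The joint law of \<open>X\<close> and \<open>Y\<close> is a coupling of their distributions, so a coupling can be given
  by random variables on any convenient probability space.\<close>

lemma transport_cost_le_of_joint_law:
  fixes X Y :: "'b \<Rightarrow> 'a::polish_space"
  assumes "prob_space N" and [measurable]: "X \<in> borel_measurable N" "Y \<in> borel_measurable N"
  shows "transport_cost p (distr N borel X) (distr N borel Y)
    \<le> (\<integral>\<^sup>+ \<omega>. ennreal (dist (X \<omega>) (Y \<omega>) powr p) \<partial>N)"
proof -
  interpret prob_space N by fact
  define \<gamma> where "\<gamma> = distr N borel (\<lambda>\<omega>. (X \<omega>, Y \<omega>))"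
  have [measurable]: "(\<lambda>\<omega>. (X \<omega>, Y \<omega>)) \<in> borel_measurable N"
    unfolding borel_prod[symmetric] by measurable
  have [measurable]: "(fst :: 'a \<times> 'a \<Rightarrow> 'a) \<in> borel_measurable borel"
      "(snd :: 'a \<times> 'a \<Rightarrow> 'a) \<in> borel_measurable borel"
    by (auto intro!: borel_measurable_continuous_onI continuous_intros)
  have "\<gamma> \<in> couplings (distr N borel X) (distr N borel Y)"
    unfolding couplings_def \<gamma>_def
    by (auto simp: borel_probs_iff prob_space_distr distr_distr comp_def)
  then have "transport_cost p (distr N borel X) (distr N borel Y)
      \<le> (\<integral>\<^sup>+ (\<xi>, \<zeta>). ennreal (dist \<xi> \<zeta> powr p) \<partial>\<gamma>)"
    unfolding transport_cost_def by (rule INF_lower)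
  also have "\<dots> = (\<integral>\<^sup>+ \<omega>. ennreal (dist (X \<omega>) (Y \<omega>) powr p) \<partial>N)"
    unfolding \<gamma>_def by (subst nn_integral_distr) (auto simp: split_beta')
  finally show ?thesis .
qed

lemma wasserstein_le_of_transport_cost_le:
  assumes "1 \<le> p" "0 \<le> \<theta>" "transport_cost p \<mu> \<nu> \<le> ennreal (\<theta> powr p)"
  shows "wasserstein p \<mu> \<nu> \<le> ennreal \<theta>"
proof -
  have fin: "transport_cost p \<mu> \<nu> \<noteq> \<top>"
    using assms(3) by (auto simp: top_unique)
  have "enn2real (transport_cost p \<mu> \<nu>) \<le> \<theta> powr p"
    using assms(3) by (intro enn2real_leI) auto
  then have "enn2real (transport_cost p \<mu> \<nu>) powr (1 / p) \<le> (\<theta> powr p) powr (1 / p)"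
    using assms(1) by (intro powr_mono2) auto
  also have "\<dots> = \<theta>"
    using assms(1,2) by (simp add: powr_powr)
  finally show ?thesis
    using fin by (simp add: wasserstein_def ennreal_leI)
qed

text \<open>Moving only a fraction of the mass scales cost and gain alike, which makes an expensive map
  feasible. The mixture is realized by drawing \<open>\<zeta>\<close> from \<open>\<nu>\<close> and tossing an independent coin with
  success probability \<open>\<epsilon>\<close> to decide whether \<open>\<zeta>\<close> moves to \<open>T \<zeta>\<close> or stays. The coin cannot be
  replaced by a subset of the space on which to apply \<open>T\<close>, because \<open>\<nu>\<close> may have atoms.\<close>

lemma mixed_transport_le_primal_value:
  fixes \<nu> :: "'a::polish_space measure" and T :: "'a \<Rightarrow> 'a"
  assumes "1 \<le> p" "0 < \<theta>" and \<nu>: "\<nu> \<in> borel_probs"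
    and [measurable]: "\<Psi> \<in> borel_measurable borel" "T \<in> borel_measurable borel"
    and int: "integrable \<nu> \<Psi>" "integrable \<nu> (\<lambda>\<zeta>. \<Psi> (T \<zeta>))"
    and cost: "integrable \<nu> (\<lambda>\<zeta>. dist (T \<zeta>) \<zeta> powr p)"
    and \<epsilon>: "0 \<le> \<epsilon>" "\<epsilon> \<le> 1" "\<epsilon> * (\<integral>\<zeta>. dist (T \<zeta>) \<zeta> powr p \<partial>\<nu>) \<le> \<theta> powr p"
  shows "ereal ((\<integral>\<zeta>. \<Psi> \<zeta> \<partial>\<nu>) + \<epsilon> * (\<integral>\<zeta>. \<Psi> (T \<zeta>) - \<Psi> \<zeta> \<partial>\<nu>)) \<le> primal_value p \<theta> \<nu> \<Psi>"
proof -
  have sets_\<nu> [measurable_cong]: "sets \<nu> = sets borel" and "prob_space \<nu>"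
    using \<nu> by (auto simp: borel_probs_iff)
  interpret \<nu>: prob_space \<nu> by fact
  let ?B = "measure_pmf (bernoulli_pmf \<epsilon>)"
  interpret pair_prob_space \<nu> ?B ..
  define N where "N = \<nu> \<Otimes>\<^sub>M ?B"
  define S where "S = (\<lambda>\<omega>. if snd \<omega> then T (fst \<omega>) else fst \<omega> :: 'a)"
  have "prob_space N"
    unfolding N_def by (rule prob_space_axioms)
  have [measurable]: "S \<in> borel_measurable N"
    unfolding S_def N_def by measurable
  have [measurable]: "fst \<in> borel_measurable N"
    unfolding N_def by measurable
  define \<mu> where "\<mu> = distr N borel S"
  have "distr N borel fst = distr N \<nu> fst"
    by (rule distr_cong) (auto simp: sets_\<nu>)
  also have "\<dots> = \<nu>"
    unfolding N_def by (rule measure_pmf.distr_pair_fst)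
  finally have marginal: "distr N borel fst = \<nu>" .
  have "transport_cost p \<mu> \<nu> \<le> (\<integral>\<^sup>+ \<omega>. ennreal (dist (S \<omega>) (fst \<omega>) powr p) \<partial>N)"
    using transport_cost_le_of_joint_law[OF \<open>prob_space N\<close>, of S fst p]
    by (simp add: \<mu>_def marginal)
  also have "\<dots> = (\<integral>\<^sup>+ \<zeta>. \<integral>\<^sup>+ b. ennreal (dist (S (\<zeta>, b)) \<zeta> powr p) \<partial>?B \<partial>\<nu>)"
    unfolding N_def by (subst measure_pmf.nn_integral_fst[symmetric]) (auto simp: S_def)
  also have "\<dots> = (\<integral>\<^sup>+ \<zeta>. ennreal (dist (T \<zeta>) \<zeta> powr p) * ennreal \<epsilon> \<partial>\<nu>)"
    using \<epsilon> by (auto simp: S_def intro!: nn_integral_cong)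
  also have "\<dots> = (\<integral>\<^sup>+ \<zeta>. ennreal (dist (T \<zeta>) \<zeta> powr p) \<partial>\<nu>) * ennreal \<epsilon>"
    by (intro nn_integral_multc) measurable
  also have "\<dots> = ennreal (\<epsilon> * (\<integral>\<zeta>. dist (T \<zeta>) \<zeta> powr p \<partial>\<nu>))"
    using \<epsilon> cost by (simp add: nn_integral_eq_integral ennreal_mult' mult.commute)
  also have "\<dots> \<le> ennreal (\<theta> powr p)"
    using \<epsilon>(3) by (rule ennreal_leI)
  finally have W: "wasserstein p \<mu> \<nu> \<le> ennreal \<theta>"
    using assms(1,2) by (intro wasserstein_le_of_transport_cost_le) auto
  have S_int: "integrable N (\<lambda>\<omega>. \<Psi> (S \<omega>))"
    unfolding N_def
  proof (rule Fubini_integrable)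
    show "(\<lambda>\<omega>. \<Psi> (S \<omega>)) \<in> borel_measurable (\<nu> \<Otimes>\<^sub>M ?B)"
      unfolding N_def[symmetric] by measurable
    show "integrable \<nu> (\<lambda>\<zeta>. \<integral>b. norm (\<Psi> (S (\<zeta>, b))) \<partial>?B)"
      using \<epsilon> int by (simp add: S_def)
    show "AE \<zeta> in \<nu>. integrable ?B (\<lambda>b. \<Psi> (S (\<zeta>, b)))"
      by (auto intro!: integrable_measure_pmf_finite)
  qed
  have "(\<integral>\<omega>. \<Psi> (S \<omega>) \<partial>N) = (\<integral>\<zeta>. \<integral>b. \<Psi> (S (\<zeta>, b)) \<partial>?B \<partial>\<nu>)"
    using S_int unfolding N_def by (rule integral_fst'[symmetric])
  also have "\<dots> = (\<integral>\<zeta>. \<Psi> \<zeta> + \<epsilon> * (\<Psi> (T \<zeta>) - \<Psi> \<zeta>) \<partial>\<nu>)"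
    using \<epsilon> by (simp add: S_def algebra_simps)
  also have "\<dots> = (\<integral>\<zeta>. \<Psi> \<zeta> \<partial>\<nu>) + \<epsilon> * (\<integral>\<zeta>. \<Psi> (T \<zeta>) - \<Psi> \<zeta> \<partial>\<nu>)"
    using int by simp
  finally have val: "(\<integral>\<xi>. \<Psi> \<xi> \<partial>\<mu>) = (\<integral>\<zeta>. \<Psi> \<zeta> \<partial>\<nu>) + \<epsilon> * (\<integral>\<zeta>. \<Psi> (T \<zeta>) - \<Psi> \<zeta> \<partial>\<nu>)"
    by (simp add: \<mu>_def integral_distr)
  have "integrable \<mu> \<Psi>"
    using S_int by (simp add: \<mu>_def integrable_distr_eq)
  moreover have "\<mu> \<in> borel_probs"
    using \<open>prob_space N\<close> by (auto simp: borel_probs_iff \<mu>_def intro: prob_space.prob_space_distr)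
  ultimately have "ext_integral \<mu> (\<lambda>\<xi>. ereal (\<Psi> \<xi>)) \<le> primal_value p \<theta> \<nu> \<Psi>"
    unfolding primal_value_def using W by (intro SUP_upper) (auto intro: ext_integral_eq_integral)
  then show ?thesis
    using ext_integral_eq_integral(2)[OF \<open>integrable \<mu> \<Psi>\<close>] val by simp
qed

section \<open>Almost optimal transport maps\<close>

text \<open>The strict hypographs of the functions \<open>f \<xi>\<close> are open subsets of a second countable space, so
  countably many of them already cover their union. Taking hypographs rather than superlevel sets
  handles all levels \<open>r\<close> with one application of Lindelof's theorem.\<close>

lemma countable_subfamily_same_pointwise_SUP:
  fixes f :: "'b \<Rightarrow> 'a::second_countable_topology \<Rightarrow> real"
  assumes "\<And>\<xi>. continuous_on UNIV (f \<xi>)"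
  shows "\<exists>x :: nat \<Rightarrow> 'b. \<forall>\<xi> \<zeta> r. r < f \<xi> \<zeta> \<longrightarrow> (\<exists>n. r < f (x n) \<zeta>)"
proof -
  define H where "H = (\<lambda>\<xi>. {z :: 'a \<times> real. snd z < f \<xi> (fst z)})"
  have "open (H \<xi>)" for \<xi>
  proof -
    have "continuous_on UNIV (\<lambda>z :: 'a \<times> real. f \<xi> (fst z))"
      by (rule continuous_on_compose2[OF assms continuous_on_fst[OF continuous_on_id]]) simp
    then show ?thesis
      unfolding H_def by (intro open_Collect_less continuous_on_snd continuous_on_id)
  qed
  then have "open U" if "U \<in> range H" for U
    using that by auto
  from Lindelof[OF this] obtain \<H> where \<H>: "\<H> \<subseteq> range H" "countable \<H>" "\<Union>\<H> = \<Union>(range H)"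
    by auto
  then obtain D where D: "countable D" "\<H> = H ` D"
    using countable_subset_image[of \<H> H UNIV] by auto
  have ex: "\<exists>\<xi>'\<in>D. r < f \<xi>' \<zeta>" if "r < f \<xi> \<zeta>" for \<xi> \<zeta> r
  proof -
    have "(\<zeta>, r) \<in> H \<xi>"
      using that by (simp add: H_def)
    then have "(\<zeta>, r) \<in> \<Union>(H ` D)"
      unfolding D(2)[symmetric] \<H>(3) by blast
    then show ?thesis
      by (auto simp: H_def)
  qed
  then have "D \<noteq> {}"
    using lt_ex by (metis empty_iff)
  then have range_D: "range (from_nat_into D) = D"
    using D(1) by (rule range_from_nat_into)
  have "\<exists>n. r < f (from_nat_into D n) \<zeta>" if "r < f \<xi> \<zeta>" for \<xi> \<zeta> r
    using ex[OF that] by (subst (asm) range_D[symmetric]) auto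
  then show ?thesis
    by blast
qed

text \<open>The best move from \<open>\<zeta>\<close>, under the score \<open>s\<close>, among staying put and the targets
  \<open>x 0, \<dots>, x (n - 1)\<close>. Updating the incumbent one target at a time gives measurability and
  monotonicity in \<open>n\<close> by plain induction.\<close>

primrec greedy_map :: "('a \<Rightarrow> 'a \<Rightarrow> real) \<Rightarrow> (nat \<Rightarrow> 'a) \<Rightarrow> nat \<Rightarrow> 'a \<Rightarrow> 'a" where
  "greedy_map s x 0 \<zeta> = \<zeta>"
| "greedy_map s x (Suc n) \<zeta> =
     (if s (greedy_map s x n \<zeta>) \<zeta> < s (x n) \<zeta> then x n else greedy_map s x n \<zeta>)"

lemma greedy_map_mono:
  assumes "m \<le> n"
  shows "s (greedy_map s x m \<zeta>) \<zeta> \<le> s (greedy_map s x n \<zeta>) \<zeta>"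
  using assms by (induction n rule: dec_induct) auto

lemma greedy_map_ge_candidate: "s (x n) \<zeta> \<le> s (greedy_map s x (Suc n) \<zeta>) \<zeta>"
  by simp

lemma measurable_greedy_map:
  fixes s :: "'a::polish_space \<Rightarrow> 'a \<Rightarrow> real"
  assumes "(\<lambda>(\<xi>, \<zeta>). s \<xi> \<zeta>) \<in> borel_measurable (borel \<Otimes>\<^sub>M borel)"
  shows "greedy_map s x n \<in> borel_measurable borel"
proof (induction n)
  case (Suc n)
  note [measurable] = assms Suc
  have "(\<lambda>\<zeta>. s (greedy_map s x n \<zeta>) \<zeta>) \<in> borel_measurable borel"
      "(\<lambda>\<zeta>. s (x n) \<zeta>) \<in> borel_measurable borel"
    using measurable_compose[OF measurable_Pair[OF Suc measurable_ident] assms]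
      measurable_compose[OF measurable_Pair[OF measurable_const[of "x n"] measurable_ident] assms]
    by simp_all
  note [measurable] = this
  have "greedy_map s x (Suc n) = (\<lambda>\<zeta>. if s (greedy_map s x n \<zeta>) \<zeta> < s (x n) \<zeta> then x n
      else greedy_map s x n \<zeta>)"
    by (rule ext) simp
  also have "\<dots> \<in> borel_measurable borel"
    by measurable
  finally show ?case .
next
  case 0
  have "greedy_map s x 0 = (\<lambda>\<zeta>. \<zeta>)"
    by (rule ext) simp
  then show ?case
    by simp
qed

text \<open>Only finitely many values of \<open>\<Psi>\<close> are added to those on the points that stay, and constants are
  integrable against a probability measure.\<close>

lemma integrable_greedy_map:
  fixes \<nu> :: "'a::polish_space measure" and \<Psi> :: "'a \<Rightarrow> real"
  assumes "prob_space \<nu>" and [measurable_cong]: "sets \<nu> = sets borel"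
    and [measurable]: "\<Psi> \<in> borel_measurable borel"
    and s: "(\<lambda>(\<xi>, \<zeta>). s \<xi> \<zeta>) \<in> borel_measurable (borel \<Otimes>\<^sub>M borel)"
    and "integrable \<nu> \<Psi>"
  shows "integrable \<nu> (\<lambda>\<zeta>. \<Psi> (greedy_map s x n \<zeta>))"
proof (induction n)
  case 0
  then show ?case
    using assms(5) by simp
next
  case (Suc n)
  interpret prob_space \<nu> by fact
  note [measurable] = measurable_greedy_map[OF s]
  have "integrable \<nu> (\<lambda>\<zeta>. \<bar>\<Psi> (greedy_map s x n \<zeta>)\<bar> + \<bar>\<Psi> (x n)\<bar>)"
    using Suc by simp
  then show ?case
  proof (rule Bochner_Integration.integrable_bound)
    show "(\<lambda>\<zeta>. \<Psi> (greedy_map s x (Suc n) \<zeta>)) \<in> borel_measurable \<nu>"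
      by measurable
    show "AE \<zeta> in \<nu>. norm (\<Psi> (greedy_map s x (Suc n) \<zeta>))
        \<le> norm (\<bar>\<Psi> (greedy_map s x n \<zeta>)\<bar> + \<bar>\<Psi> (x n)\<bar>)"
      by (intro AE_I2) auto
  qed
qed

text \<open>The greedy maps have net gains increasing to \<open>\<integral> - Phi p \<Psi> l - \<Psi>\<close>, which is infinite. Starting
  from the identity keeps every net gain \<open>g n\<close> nonnegative; this is what allows monotone
  convergence, and it bounds the cost of a move by the increase of \<open>\<Psi>\<close>.\<close>

lemma ex_transport_map_with_large_net_gain:
  fixes \<nu> :: "'a::polish_space measure" and \<Psi> :: "'a \<Rightarrow> real"
  assumes "1 \<le> p" "0 < l" and \<nu>: "\<nu> \<in> borel_probs"
    and [measurable]: "\<Psi> \<in> borel_measurable borel" and int: "integrable \<nu> \<Psi>"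
    and inf: "ext_integral \<nu> (Phi p \<Psi> l) = - \<infinity>"
  obtains T where "T \<in> borel_measurable borel" "integrable \<nu> (\<lambda>\<zeta>. \<Psi> (T \<zeta>))"
    "integrable \<nu> (\<lambda>\<zeta>. dist (T \<zeta>) \<zeta> powr p)"
    "M + l * (\<integral>\<zeta>. dist (T \<zeta>) \<zeta> powr p \<partial>\<nu>) \<le> (\<integral>\<zeta>. \<Psi> (T \<zeta>) - \<Psi> \<zeta> \<partial>\<nu>)"
proof -
  have sets_\<nu> [measurable_cong]: "sets \<nu> = sets borel" and "prob_space \<nu>"
    using \<nu> by (auto simp: borel_probs_iff)
  define s where "s = (\<lambda>\<xi> \<zeta>. \<Psi> \<xi> - l * dist \<xi> \<zeta> powr p)"
  have s_meas [measurable]: "(\<lambda>(\<xi>, \<zeta>). s \<xi> \<zeta>) \<in> borel_measurable (borel \<Otimes>\<^sub>M borel)"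
    unfolding s_def by measurable
  have cont: "continuous_on UNIV (s \<xi>)" for \<xi>
    unfolding s_def using assms(1) by (intro continuous_intros continuous_on_powr') auto
  obtain x :: "nat \<Rightarrow> 'a" where x: "\<And>\<xi> \<zeta> r. r < s \<xi> \<zeta> \<Longrightarrow> \<exists>n. r < s (x n) \<zeta>"
    using countable_subfamily_same_pointwise_SUP[where f = s, OF cont] by auto
  define T where "T = greedy_map s x"
  have [measurable]: "T n \<in> borel_measurable borel" for n
    unfolding T_def using s_meas by (rule measurable_greedy_map)
  have int_T: "integrable \<nu> (\<lambda>\<zeta>. \<Psi> (T n \<zeta>))" for n
    unfolding T_def using \<open>prob_space \<nu>\<close> sets_\<nu> assms(4) s_meas int by (rule integrable_greedy_map)
  define g where "g = (\<lambda>n \<zeta>. s (T n \<zeta>) \<zeta> - \<Psi> \<zeta>)"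
  have [measurable]: "g n \<in> borel_measurable borel" for n
    unfolding g_def s_def by measurable
  have g_mono: "g m \<zeta> \<le> g n \<zeta>" if "m \<le> n" for m n \<zeta>
    unfolding g_def T_def using greedy_map_mono[OF that, of s x \<zeta>] by simp
  have g_0: "g 0 \<zeta> = 0" for \<zeta>
    using assms(1) by (simp add: g_def T_def s_def)
  have g_nonneg: "0 \<le> g n \<zeta>" for n \<zeta>
    using g_mono[of 0 n \<zeta>] g_0 by simp
  have int_d: "integrable \<nu> (\<lambda>\<zeta>. dist (T n \<zeta>) \<zeta> powr p)" for n
  proof -
    have "integrable \<nu> (\<lambda>\<zeta>. (\<Psi> (T n \<zeta>) - \<Psi> \<zeta>) / l)"
      using int int_T by simp
    moreover have "dist (T n \<zeta>) \<zeta> powr p \<le> (\<Psi> (T n \<zeta>) - \<Psi> \<zeta>) / l" for \<zeta>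
      using g_nonneg[of n \<zeta>] \<open>0 < l\<close> by (simp add: g_def s_def field_simps)
    moreover have "(\<lambda>\<zeta>. dist (T n \<zeta>) \<zeta> powr p) \<in> borel_measurable \<nu>"
      by measurable
    ultimately show ?thesis
      by (elim Bochner_Integration.integrable_bound)
        (auto intro!: AE_I2 order_trans[OF _ abs_ge_self] simp del: abs_divide)
  qed
  have int_g: "integrable \<nu> (g n)" for n
    unfolding g_def s_def using int int_T int_d by simp
  \<comment> \<open>The term \<open>\<bar>\<Psi> \<zeta>\<bar>\<close> has finite integral and replaces \<open>\<Psi> \<zeta>\<close>, whose sign is unknown, so
    that both sides are nonnegative.\<close>
  have le: "e2ennreal (- Phi p \<Psi> l \<zeta>) \<le> (SUP n. ennreal (g n \<zeta>)) + ennreal \<bar>\<Psi> \<zeta>\<bar>" for \<zeta>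
  proof -
    have "e2ennreal (- Phi p \<Psi> l \<zeta>) \<le> y" if y: "(SUP n. ennreal (g n \<zeta>)) + ennreal \<bar>\<Psi> \<zeta>\<bar> \<le> y" for y
    proof (cases y)
      case (real r)
      have "s \<xi> \<zeta> \<le> r" for \<xi>
      proof (rule ccontr)
        assume "\<not> s \<xi> \<zeta> \<le> r"
        then obtain n where n: "r < s (x n) \<zeta>"
          using x[of r \<xi> \<zeta>] by auto
        also have "\<dots> \<le> g (Suc n) \<zeta> + \<bar>\<Psi> \<zeta>\<bar>"
          using greedy_map_ge_candidate[of s x n \<zeta>] by (auto simp: g_def T_def simp del: greedy_map.simps)
        finally have "r < g (Suc n) \<zeta> + \<bar>\<Psi> \<zeta>\<bar>" .
        moreover have "ennreal (g (Suc n) \<zeta> + \<bar>\<Psi> \<zeta>\<bar>) \<le> ennreal r"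
        proof -
          have "ennreal (g (Suc n) \<zeta> + \<bar>\<Psi> \<zeta>\<bar>) = ennreal (g (Suc n) \<zeta>) + ennreal \<bar>\<Psi> \<zeta>\<bar>"
            using g_nonneg by (simp add: ennreal_plus)
          also have "\<dots> \<le> (SUP n. ennreal (g n \<zeta>)) + ennreal \<bar>\<Psi> \<zeta>\<bar>"
            by (intro add_right_mono SUP_upper) auto
          also note y
          finally show ?thesis
            unfolding real .
        qed
        ultimately show False
          using real by simp
      qed
      then have "ereal (- r) \<le> Phi p \<Psi> l \<zeta>"
        unfolding Phi_def by (intro INF_greatest) (auto simp: s_def algebra_simps)
      then have "e2ennreal (- Phi p \<Psi> l \<zeta>) \<le> e2ennreal (ereal r)"
        by (intro e2ennreal_mono) (simp add: ereal_uminus_le_reorder)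
      then show ?thesis
        using real by simp
    qed simp
    then show ?thesis
      by simp
  qed
  have "\<top> = (\<integral>\<^sup>+ \<zeta>. e2ennreal (- Phi p \<Psi> l \<zeta>) \<partial>\<nu>)"
    using inf by (simp add: ext_integral_eq_MInfty_iff)
  also have "\<dots> \<le> (\<integral>\<^sup>+ \<zeta>. (SUP n. ennreal (g n \<zeta>)) + ennreal \<bar>\<Psi> \<zeta>\<bar> \<partial>\<nu>)"
    by (intro nn_integral_mono le)
  also have "\<dots> = (\<integral>\<^sup>+ \<zeta>. (SUP n. ennreal (g n \<zeta>)) \<partial>\<nu>) + (\<integral>\<^sup>+ \<zeta>. ennreal \<bar>\<Psi> \<zeta>\<bar> \<partial>\<nu>)"
    by (rule nn_integral_add) auto
  finally have "(\<integral>\<^sup>+ \<zeta>. (SUP n. ennreal (g n \<zeta>)) \<partial>\<nu>) = \<top>"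
    using int by (auto simp: integrable_iff_bounded top_unique)
  moreover have "(\<integral>\<^sup>+ \<zeta>. (SUP n. ennreal (g n \<zeta>)) \<partial>\<nu>) = (SUP n. \<integral>\<^sup>+ \<zeta>. ennreal (g n \<zeta>) \<partial>\<nu>)"
    by (intro nn_integral_monotone_convergence_SUP)
       (auto simp: incseq_def le_fun_def intro!: ennreal_leI g_mono)
  ultimately have SUP_top: "(SUP n. \<integral>\<^sup>+ \<zeta>. ennreal (g n \<zeta>) \<partial>\<nu>) = \<top>"
    by argo
  have "ennreal M < (SUP n. \<integral>\<^sup>+ \<zeta>. ennreal (g n \<zeta>) \<partial>\<nu>)"
    unfolding SUP_top by simp
  then obtain n where n: "ennreal M < (\<integral>\<^sup>+ \<zeta>. ennreal (g n \<zeta>) \<partial>\<nu>)"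
    by (auto simp: less_SUP_iff)
  then have "ennreal M < ennreal (\<integral>\<zeta>. g n \<zeta> \<partial>\<nu>)"
    using int_g g_nonneg by (simp add: nn_integral_eq_integral)
  then have "M \<le> (\<integral>\<zeta>. g n \<zeta> \<partial>\<nu>)"
    by (meson ennreal_leI linear not_le)
  also have "\<dots> = (\<integral>\<zeta>. (\<Psi> (T n \<zeta>) - \<Psi> \<zeta>) - l * dist (T n \<zeta>) \<zeta> powr p \<partial>\<nu>)"
    by (simp add: g_def s_def algebra_simps)
  also have "\<dots> = (\<integral>\<zeta>. \<Psi> (T n \<zeta>) - \<Psi> \<zeta> \<partial>\<nu>) - l * (\<integral>\<zeta>. dist (T n \<zeta>) \<zeta> powr p \<partial>\<nu>)"
    using int int_T int_d by simp
  finally show thesis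
    using int_T int_d by (intro that[of "T n"]) auto
qed

section \<open>Infinite growth rate\<close>

theorem proposition2:
  fixes \<nu> :: "'a::polish_space measure" and \<Psi> :: "'a \<Rightarrow> real" and p \<theta> :: real
  assumes "1 \<le> p"
    and "\<nu> \<in> borel_probs"
    and "0 < \<theta>"
    and "\<Psi> \<in> borel_measurable borel"
    and "integrable \<nu> \<Psi>"
    and "growth_rate p \<nu> \<Psi> = \<infinity>"
  shows "primal_value p \<theta> \<nu> \<Psi> = \<infinity> \<and> dual_value p \<theta> \<nu> \<Psi> = \<infinity>"
proof
  note Phi_inf = ext_integral_Phi_of_infinite_growth_rate[OF assms(6)]
  show "dual_value p \<theta> \<nu> \<Psi> = \<infinity>"
    by (simp add: dual_value_def Phi_inf)
  show "primal_value p \<theta> \<nu> \<Psi> = \<infinity>"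
  proof (rule ereal_top)
    fix K :: real
    define c where "c = \<theta> powr p"
    have "0 < c"
      using assms(3) by (simp add: c_def)
    \<comment> \<open>The price at which a gain of \<open>l * c\<close> lifts the value to \<open>K\<close>; it must be positive for the
      cost to be controlled.\<close>
    define l where "l = max 1 ((K - (\<integral>\<zeta>. \<Psi> \<zeta> \<partial>\<nu>)) / c)"
    have l: "0 < l" and K: "K \<le> (\<integral>\<zeta>. \<Psi> \<zeta> \<partial>\<nu>) + l * c"
      using \<open>0 < c\<close> by (auto simp: l_def field_simps max_def)
    obtain T where T: "T \<in> borel_measurable borel" "integrable \<nu> (\<lambda>\<zeta>. \<Psi> (T \<zeta>))"
        "integrable \<nu> (\<lambda>\<zeta>. dist (T \<zeta>) \<zeta> powr p)"
        "l * c + l * (\<integral>\<zeta>. dist (T \<zeta>) \<zeta> powr p \<partial>\<nu>) \<le> (\<integral>\<zeta>. \<Psi> (T \<zeta>) - \<Psi> \<zeta> \<partial>\<nu>)"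
      by (rule ex_transport_map_with_large_net_gain[where M = "l * c",
            OF assms(1) l assms(2,4,5) Phi_inf[OF less_imp_le[OF l]]])
    define A where "A = (\<integral>\<zeta>. dist (T \<zeta>) \<zeta> powr p \<partial>\<nu>)"
    define B where "B = (\<integral>\<zeta>. \<Psi> (T \<zeta>) - \<Psi> \<zeta> \<partial>\<nu>)"
    have "0 \<le> A"
      by (simp add: A_def)
    have B: "l * c + l * A \<le> B"
      using T(4) by (simp add: A_def B_def)
    have "0 \<le> l * c" "0 \<le> l * A"
      using l \<open>0 < c\<close> \<open>0 \<le> A\<close> by auto
    \<comment> \<open>The largest fraction of the mass that can be moved within the budget \<open>c\<close>; the maximum covers
      the case \<open>A = 0\<close>.\<close>
    define \<epsilon> where "\<epsilon> = c / max c A"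
    have \<epsilon>: "0 \<le> \<epsilon>" "\<epsilon> \<le> 1" "\<epsilon> * A \<le> c"
      using \<open>0 < c\<close> \<open>0 \<le> A\<close> by (auto simp: \<epsilon>_def field_simps max_def)
    have "l * c = \<epsilon> * (l * max c A)"
      using \<open>0 < c\<close> by (simp add: \<epsilon>_def)
    also have "\<dots> \<le> \<epsilon> * B"
      using \<epsilon>(1) B \<open>0 \<le> l * c\<close> \<open>0 \<le> l * A\<close> by (intro mult_left_mono) (auto simp: max_def)
    finally have "ereal K \<le> ereal ((\<integral>\<zeta>. \<Psi> \<zeta> \<partial>\<nu>) + \<epsilon> * B)"
      using K by simp
    also have "\<dots> \<le> primal_value p \<theta> \<nu> \<Psi>"
      unfolding B_def using assms T \<epsilon>
      by (intro mixed_transport_le_primal_value) (auto simp: A_def c_def)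
    finally show "ereal K \<le> primal_value p \<theta> \<nu> \<Psi>" .
  qed
qed

end
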